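(* Let $G=(V,E,w,\mu)$ be a weighted undirected graph. Then the balanced cut value $$h(G)=\min_{S\subset V,\ S\notin\{\emptyset,V\}} \frac{|E( S,S^c)|}{\min\{\mathrm{vol}(S),\mathrm{vol}(S^c)\}}$$ satisfies $$h(G)=\min_{\text{nonconstant } x\in\mathbb{R}^n}\frac{e\|x\|_{\infty}-I^+(x)}{N(x)}.$$
   Context: $G=(V,E,w,\mu)$ is an undirected graph without loops, $V=\{1,\dots,n\}$, $n\ge 2$; $\mu_i>0$ is a weight on each vertex $i$; $w_{ij}=w_{ji}>0$ if $\{i,j\}\in E$ and $w_{ij}=0$ otherwise. $d_i=\sum_{j:\{i,j\}\in E}w_{ij}$, $e=\sum_{i\in V}d_i$. For $S\subset V$: $S^c=V\setminus S$ and $\mathrm{vol}(S)=\sum_{i\in S}\mu_i$. For $S,T\subset V$, $E(S,T)$ is the set of edges between $S$ and $T$ and $|E(S,T)|=\sum_{\{i,j\}\in E(S,T)}w_{ij}$ (total weight). For $x\in\mathbb{R}^n$: $\|x\|_\infty=\max_i|x_i|$, $I^+(x)=\sum_{\{i,j\}\in E}w_{ij}|x_i+x_j|$, $N(x)=\min_{c\in\mathbb{R}}\sum_{i\in V}\mu_i|x_i-c|$. "Nonconstant" means that not all components of $x$ are equal (equivalently $N(x)>0$). *)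

theory Defs
  imports "HOL-Analysis.Analysis"
begin

text \<open>
  The vertex set is the universe of a finite type \<open>'n\<close>, so \<open>n = CARD('n)\<close> and a vector in
  \<open>R^n\<close> has type \<open>real ^ 'n\<close>. Edges are two-element sets of vertices.
\<close>

locale weighted_graph =
  fixes E :: "'n::finite set set"
    and w :: "'n \<Rightarrow> 'n \<Rightarrow> real"
    and \<mu> :: "'n \<Rightarrow> real"
  assumes card_vertices: "CARD('n) \<ge> 2"
    and no_loops: "\<And>F. F \<in> E \<Longrightarrow> card F = 2"
    and weight_sym: "\<And>i j. w i j = w j i"
    and weight_pos: "\<And>i j. {i, j} \<in> E \<Longrightarrow> w i j > 0"
    and weight_zero: "\<And>i j. {i, j} \<notin> E \<Longrightarrow> w i j = 0"
    and vertex_weight_pos: "\<And>i. \<mu> i > 0"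

text \<open>
  Sum of a symmetric quantity \<open>f i j\<close> over the undirected edges \<open>{i, j} \<in> F\<close>. Each edge (there
  are no loops) arises from exactly two ordered pairs, hence the factor \<open>1 / 2\<close>; the two
  lemmas below confirm that every edge counts once.
\<close>

definition edge_sum :: "'n::finite set set \<Rightarrow> ('n \<Rightarrow> 'n \<Rightarrow> real) \<Rightarrow> real" where
  "edge_sum F f = (\<Sum>(i, j) \<in> {(i, j). {i, j} \<in> F}. f i j) / 2"

lemma edge_sum_empty: "edge_sum {} f = 0"
  by (simp add: edge_sum_def)

lemma edge_sum_insert:
  fixes i j :: "'n::finite"
  assumes "i \<noteq> j" "{i, j} \<notin> F" "f i j = f j i"
  shows "edge_sum (insert {i, j} F) f = f i j + edge_sum F f"
proof -
  have "{(a, b). {a, b} \<in> insert {i, j} F} = insert (i, j) (insert (j, i) {(a, b). {a, b} \<in> F})"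
    by (auto simp: doubleton_eq_iff)
  moreover have "{j, i} \<notin> F" using assms(2) by (simp add: insert_commute)
  ultimately show ?thesis
    using assms by (simp add: edge_sum_def add_divide_distrib)
qed

definition vertex_degree :: "'n::finite set set \<Rightarrow> ('n \<Rightarrow> 'n \<Rightarrow> real) \<Rightarrow> 'n \<Rightarrow> real" where
  "vertex_degree E w i = (\<Sum>j | {i, j} \<in> E. w i j)"

definition total_degree :: "'n::finite set set \<Rightarrow> ('n \<Rightarrow> 'n \<Rightarrow> real) \<Rightarrow> real" where
  "total_degree E w = (\<Sum>i\<in>UNIV. vertex_degree E w i)"

definition vol :: "('n::finite \<Rightarrow> real) \<Rightarrow> 'n set \<Rightarrow> real" where
  "vol \<mu> S = (\<Sum>i\<in>S. \<mu> i)"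

definition edges_between :: "'n::finite set set \<Rightarrow> 'n set \<Rightarrow> 'n set \<Rightarrow> 'n set set" where
  "edges_between E S T = {{i, j} | i j. i \<in> S \<and> j \<in> T \<and> {i, j} \<in> E}"

definition balanced_cut ::
  "'n::finite set set \<Rightarrow> ('n \<Rightarrow> 'n \<Rightarrow> real) \<Rightarrow> ('n \<Rightarrow> real) \<Rightarrow> real" where
  "balanced_cut E w \<mu> =
     Min {edge_sum (edges_between E S (- S)) w / min (vol \<mu> S) (vol \<mu> (- S)) | S. S \<notin> {{}, UNIV}}"

definition I_plus :: "'n::finite set set \<Rightarrow> ('n \<Rightarrow> 'n \<Rightarrow> real) \<Rightarrow> real ^ 'n \<Rightarrow> real" where
  "I_plus E w x = edge_sum E (\<lambda>i j. w i j * \<bar>x $ i + x $ j\<bar>)"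

definition N_fun :: "('n::finite \<Rightarrow> real) \<Rightarrow> real ^ 'n \<Rightarrow> real" where
  "N_fun \<mu> x = (LEAST t. t \<in> range (\<lambda>c. \<Sum>i\<in>UNIV. \<mu> i * \<bar>x $ i - c\<bar>))"

text \<open>The least value in the definition of \<open>N_fun\<close> exists:\<close>

lemma N_fun_is_minimum:
  fixes x :: "real ^ 'n"
  assumes "\<And>i. \<mu> i \<ge> 0"
  shows "\<exists>c. N_fun \<mu> x = (\<Sum>i\<in>UNIV. \<mu> i * \<bar>x $ i - c\<bar>)"
    and "N_fun \<mu> x \<le> (\<Sum>i\<in>UNIV. \<mu> i * \<bar>x $ i - c\<bar>)"
proof -
  define f where "f c = (\<Sum>i\<in>UNIV. \<mu> i * \<bar>x $ i - c\<bar>)" for c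
  define M where "M = infnorm x"
  have M: "\<bar>x $ i\<bar> \<le> M" for i
    unfolding M_def by (rule component_le_infnorm_cart)
  have "M \<ge> 0" by (simp add: M_def infnorm_pos_le)
  have "continuous_on {-M..M} f"
    unfolding f_def by (intro continuous_intros)
  then obtain m where m: "\<And>c. c \<in> {-M..M} \<Longrightarrow> f m \<le> f c"
    using continuous_attains_inf[of "{-M..M}" f] \<open>M \<ge> 0\<close>
    by (metis atLeastAtMost_iff compact_Icc empty_iff neg_le_0_iff_le)
  have le: "f m \<le> f c" for c
  proof -
    have "f m \<le> f (max (- M) (min M c))"
      using \<open>M \<ge> 0\<close> by (intro m) auto
    also have "\<dots> \<le> f c"
      unfolding f_def
    proof (intro sum_mono mult_left_mono assms)
      fix i
      show "\<bar>x $ i - max (- M) (min M c)\<bar> \<le> \<bar>x $ i - c\<bar>"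
        using M[of i] \<open>M \<ge> 0\<close> by linarith
    qed
    finally show ?thesis .
  qed
  have "N_fun \<mu> x = f m"
    unfolding N_fun_def f_def[symmetric] using le by (intro Least_equality) auto
  then show "\<exists>c. N_fun \<mu> x = (\<Sum>i\<in>UNIV. \<mu> i * \<bar>x $ i - c\<bar>)"
    and "N_fun \<mu> x \<le> (\<Sum>i\<in>UNIV. \<mu> i * \<bar>x $ i - c\<bar>)"
    using le by (auto simp: f_def)
qed

definition nonconstant :: "real ^ 'n \<Rightarrow> bool" where
  "nonconstant x \<longleftrightarrow> (\<exists>i j. x $ i \<noteq> x $ j)"

end

theory Submission
  imports Defs
begin

text \<open>
  Put \<open>M = infnorm x\<close>. Since \<open>e\<close> counts the weight of every edge twice, the numerator
  \<open>e M - I\<^sup>+(x)\<close> is the sum over the edges of \<open>w\<^sub>i\<^sub>j (2 M - \<bar>x\<^sub>i + x\<^sub>j\<bar>)\<close>. From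
  \<open>\<bar>a + b\<bar> + \<bar>a - b\<bar> = 2 max \<bar>a\<bar> \<bar>b\<bar> \<le> 2 M\<close> it follows that the numerator is at least the total
  variation \<open>TV(x)\<close>, the sum of \<open>w\<^sub>i\<^sub>j \<bar>x\<^sub>i - x\<^sub>j\<bar>\<close> (\<open>total_variation_le_numerator\<close>), with equality
  if all \<open>\<bar>x\<^sub>i\<bar>\<close> are equal.

  The lower bound is therefore the Cheeger type inequality \<open>h N(x) \<le> TV(x)\<close>
  (\<open>cut_bound_imp_variation_bound\<close>). It is proved by slicing the top level off \<open>x\<close>, that is, by
  writing \<open>x = y + d 1\<^sub>S\<close>, where \<open>S\<close> is the set on which \<open>x\<close> is maximal and \<open>d\<close> is the gap between
  the two largest values. The total variation is additive along this decomposition, whereas \<open>N\<close> is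
  subadditive, and \<open>N(1\<^sub>S)\<close> is at most \<open>min (vol S) (vol S\<^sup>c)\<close> because \<open>c = 0\<close> and \<open>c = 1\<close> are
  admissible in the minimum. So no median of \<open>x\<close> has to be located, and induction on the number
  of distinct values of \<open>x\<close> suffices.

  The bound is attained at \<open>x = 1\<^sub>S - 1\<^bsub>S\<^sup>c\<^esub>\<close> for an optimal cut \<open>S\<close>: the numerator is then twice
  the cut weight, and \<open>N(x) \<ge> 2 min (vol S) (vol S\<^sup>c)\<close> (\<open>N_fun_sign_vector\<close>).
\<close>

section \<open>The seminorm N\<close>

lemma N_fun_nonneg:
  assumes "\<And>i. \<mu> i \<ge> 0"
  shows "N_fun \<mu> x \<ge> 0"
  using N_fun_is_minimum(1)[of \<mu> x] assms by (auto intro!: sum_nonneg)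

lemma N_fun_pos:
  assumes "\<And>i. \<mu> i > 0" and "nonconstant x"
  shows "N_fun \<mu> x > 0"
proof -
  obtain c where c: "N_fun \<mu> x = (\<Sum>i\<in>UNIV. \<mu> i * \<bar>x $ i - c\<bar>)"
    using N_fun_is_minimum(1)[of \<mu> x] assms(1) less_imp_le by blast
  obtain k where "x $ k \<noteq> c"
    using assms(2) unfolding nonconstant_def by metis
  then have "\<mu> k * \<bar>x $ k - c\<bar> > 0"
    using assms(1)[of k] by simp
  then show ?thesis
    unfolding c using assms(1) by (intro sum_pos2[of _ k]) (auto simp: less_imp_le)
qed

lemma N_fun_const:
  assumes "\<And>i. \<mu> i \<ge> 0" and "\<And>i. x $ i = c"
  shows "N_fun \<mu> x = 0"
  using N_fun_is_minimum(2)[of \<mu> x c] N_fun_nonneg[of \<mu> x] assms by simp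

text \<open>Optimal shifts \<open>c\<close> and \<open>c'\<close> for the two summands give the admissible shift \<open>c + c'\<close>.\<close>

lemma N_fun_subadditive:
  assumes "\<And>i. \<mu> i \<ge> 0"
  shows "N_fun \<mu> (x + y) \<le> N_fun \<mu> x + N_fun \<mu> y"
proof -
  obtain c where c: "N_fun \<mu> x = (\<Sum>i\<in>UNIV. \<mu> i * \<bar>x $ i - c\<bar>)"
    using N_fun_is_minimum(1)[of \<mu> x] assms by blast
  obtain c' where c': "N_fun \<mu> y = (\<Sum>i\<in>UNIV. \<mu> i * \<bar>y $ i - c'\<bar>)"
    using N_fun_is_minimum(1)[of \<mu> y] assms by blast
  have "N_fun \<mu> (x + y) \<le> (\<Sum>i\<in>UNIV. \<mu> i * \<bar>(x + y) $ i - (c + c')\<bar>)"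
    by (rule N_fun_is_minimum(2)) (rule assms)
  also have "\<dots> \<le> (\<Sum>i\<in>UNIV. \<mu> i * (\<bar>x $ i - c\<bar> + \<bar>y $ i - c'\<bar>))"
    by (intro sum_mono mult_left_mono assms) (simp; linarith)
  also have "\<dots> = N_fun \<mu> x + N_fun \<mu> y"
    by (simp add: c c' distrib_left sum.distrib)
  finally show ?thesis .
qed

lemma N_fun_indicator_le:
  fixes \<mu> :: "'a::finite \<Rightarrow> real"
  assumes "\<And>i. \<mu> i \<ge> 0" and "d \<ge> 0"
  shows "N_fun \<mu> (\<chi> i. d * indicator S i) \<le> d * min (vol \<mu> S) (vol \<mu> (- S))"
proof -
  let ?y = "(\<chi> i. d * indicator S i) :: real ^ 'a"
  have "(\<Sum>i\<in>UNIV. \<mu> i * \<bar>?y $ i - 0\<bar>) = (\<Sum>i\<in>UNIV. d * (if i \<in> S then \<mu> i else 0))"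
    using assms(2) by (intro sum.cong) (auto simp: indicator_def)
  also have "\<dots> = d * vol \<mu> S"
    by (simp add: vol_def sum.If_cases flip: sum_distrib_left)
  finally have 1: "N_fun \<mu> ?y \<le> d * vol \<mu> S"
    using N_fun_is_minimum(2)[of \<mu> ?y 0] assms(1) by simp
  have "(\<Sum>i\<in>UNIV. \<mu> i * \<bar>?y $ i - d\<bar>) = (\<Sum>i\<in>UNIV. d * (if i \<in> - S then \<mu> i else 0))"
    using assms(2) by (intro sum.cong) (auto simp: indicator_def)
  also have "\<dots> = d * vol \<mu> (- S)"
    by (simp add: vol_def sum.If_cases Compl_eq flip: sum_distrib_left)
  finally have 2: "N_fun \<mu> ?y \<le> d * vol \<mu> (- S)"
    using N_fun_is_minimum(2)[of \<mu> ?y d] assms(1) by simp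
  show ?thesis
    using 1 2 by (simp add: min_def)
qed

text \<open>
  A shift \<open>c\<close> costs \<open>\<bar>1 - c\<bar>\<close> on \<open>S\<close> and \<open>\<bar>1 + c\<bar>\<close> on the complement, and these two distances add
  up to at least \<open>2\<close>.
\<close>

lemma N_fun_sign_vector:
  fixes \<mu> :: "'a::finite \<Rightarrow> real"
  assumes "\<And>i. \<mu> i \<ge> 0"
  shows "2 * min (vol \<mu> S) (vol \<mu> (- S)) \<le> N_fun \<mu> (\<chi> i. if i \<in> S then 1 else - 1)"
proof -
  let ?x = "(\<chi> i. if i \<in> S then 1 else - 1) :: real ^ 'a" and ?m = "min (vol \<mu> S) (vol \<mu> (- S))"
  obtain c where c: "N_fun \<mu> ?x = (\<Sum>i\<in>UNIV. \<mu> i * \<bar>?x $ i - c\<bar>)"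
    using N_fun_is_minimum(1)[of \<mu> ?x] assms by blast
  have "?m \<ge> 0"
    using assms by (auto simp: vol_def intro!: sum_nonneg)
  have "2 * ?m \<le> (\<bar>1 - c\<bar> + \<bar>1 + c\<bar>) * ?m"
    using \<open>?m \<ge> 0\<close> by (intro mult_right_mono) linarith+
  also have "\<dots> \<le> \<bar>1 - c\<bar> * vol \<mu> S + \<bar>1 + c\<bar> * vol \<mu> (- S)"
    unfolding distrib_right by (intro add_mono mult_left_mono) auto
  also have "\<dots> = (\<Sum>i\<in>S. \<mu> i * \<bar>1 - c\<bar>) + (\<Sum>i\<in>- S. \<mu> i * \<bar>1 + c\<bar>)"
    by (simp add: vol_def sum_distrib_left sum_distrib_right mult.commute)
  also have "\<dots> = (\<Sum>i\<in>S. \<mu> i * \<bar>?x $ i - c\<bar>) + (\<Sum>i\<in>- S. \<mu> i * \<bar>?x $ i - c\<bar>)"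
    by (intro arg_cong2[where f = "(+)"] sum.cong) auto
  also have "\<dots> = (\<Sum>i\<in>UNIV. \<mu> i * \<bar>?x $ i - c\<bar>)"
    by (subst sum.union_disjoint[symmetric]) (auto simp: Compl_partition)
  finally show ?thesis
    by (simp add: c)
qed

section \<open>Total variation\<close>

definition total_variation :: "('n::finite \<Rightarrow> 'n \<Rightarrow> real) \<Rightarrow> real ^ 'n \<Rightarrow> real" where
  "total_variation w x = (\<Sum>i\<in>UNIV. \<Sum>j\<in>UNIV. w i j * \<bar>x $ i - x $ j\<bar>) / 2"

definition cut_weight :: "('n::finite \<Rightarrow> 'n \<Rightarrow> real) \<Rightarrow> 'n set \<Rightarrow> real" where
  "cut_weight w S = (\<Sum>i\<in>UNIV. \<Sum>j\<in>UNIV. if (i \<in> S) \<noteq> (j \<in> S) then w i j else 0) / 2"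

lemma total_variation_nonneg:
  assumes "\<And>i j. w i j \<ge> 0"
  shows "total_variation w x \<ge> 0"
  unfolding total_variation_def by (intro divide_nonneg_pos sum_nonneg mult_nonneg_nonneg assms) auto

text \<open>
  The decomposition behind the coarea formula, one level at a time. Truncating \<open>x\<close> at its second
  largest value keeps the order of the entries, so each difference \<open>\<bar>x\<^sub>i - x\<^sub>j\<bar>\<close> splits without loss.
\<close>

lemma slice_top_level:
  fixes x :: "real ^ 'n"
  assumes "nonconstant x"
  obtains y S d where "x = y + (\<chi> i. d * indicator S i)" "d \<ge> 0" "S \<notin> {{}, UNIV}"
    "card (range (($) y)) < card (range (($) x))"
    "\<And>w. total_variation w x = total_variation w y + d * cut_weight w S"
proof -
  define R where "R = range (($) x)"
  define m where "m = Max R"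
  define m' where "m' = Max (R - {m})"
  define S where "S = {i. x $ i = m}"
  define y where "y = (\<chi> i. min (x $ i) m')"
  have fin: "finite R" and ne: "R \<noteq> {}"
    by (auto simp: R_def)
  have "m \<in> R"
    unfolding m_def using fin ne by (rule Max_in)
  have "R - {m} \<noteq> {}"
  proof
    assume "R - {m} = {}"
    then have "x $ i = m" for i
      by (auto simp: R_def)
    then show False
      using assms by (simp add: nonconstant_def)
  qed
  then have "m' \<in> R - {m}"
    unfolding m'_def using fin by (intro Max_in) auto
  have le: "x $ i \<le> m" for i
    unfolding m_def using fin by (intro Max_ge) (auto simp: R_def)
  have le': "x $ i \<le> m'" if "i \<notin> S" for i
    unfolding m'_def using fin that by (intro Max_ge) (auto simp: R_def S_def)
  have "m' < m"
    using \<open>m' \<in> R - {m}\<close> le by (force simp: R_def less_le)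
  have y: "y $ i = (if i \<in> S then m' else x $ i)" for i
    using le'[of i] \<open>m' < m\<close> by (auto simp: y_def S_def)
  show thesis
  proof (rule that)
    show "x = y + (\<chi> i. (m - m') * indicator S i)"
      by (auto simp: vec_eq_iff y S_def)
    show "0 \<le> m - m'"
      using \<open>m' < m\<close> by simp
    show "S \<notin> {{}, UNIV}"
      using \<open>m \<in> R\<close> \<open>m' \<in> R - {m}\<close> by (auto simp: S_def R_def)
    have "range (($) y) \<subseteq> R - {m}"
      using \<open>m' \<in> R - {m}\<close> by (auto simp: y S_def R_def)
    then have "range (($) y) \<subset> R"
      using \<open>m \<in> R\<close> by auto
    then show "card (range (($) y)) < card (range (($) x))"
      using psubset_card_mono fin unfolding R_def by blast
    show "total_variation w x = total_variation w y + (m - m') * cut_weight w S" for w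
    proof -
      have "\<bar>x $ i - x $ j\<bar> = \<bar>y $ i - y $ j\<bar> + (if (i \<in> S) \<noteq> (j \<in> S) then m - m' else 0)" for i j
        using le'[of i] le'[of j] \<open>m' < m\<close> by (auto simp: y S_def)
      then have "w i j * \<bar>x $ i - x $ j\<bar> = w i j * \<bar>y $ i - y $ j\<bar>
          + (m - m') * (if (i \<in> S) \<noteq> (j \<in> S) then w i j else 0)" for i j
        by (simp add: distrib_left)
      then show ?thesis
        by (simp add: total_variation_def cut_weight_def sum.distrib add_divide_distrib
            flip: sum_distrib_left)
    qed
  qed
qed

text \<open>
  The Cheeger type inequality: a bound for cuts, which are the case of indicator vectors, extends
  to all vectors by slicing.
\<close>

lemma cut_bound_imp_variation_bound:
  fixes x :: "real ^ 'n"
  assumes w: "\<And>i j. w i j \<ge> 0" and \<mu>: "\<And>i. \<mu> i \<ge> 0" and h: "h \<ge> 0"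
    and cut: "\<And>S. S \<notin> {{}, UNIV} \<Longrightarrow> h * min (vol \<mu> S) (vol \<mu> (- S)) \<le> cut_weight w S"
  shows "h * N_fun \<mu> x \<le> total_variation w x"
proof (induction "card (range (($) x))" arbitrary: x rule: less_induct)
  case less
  show ?case
  proof (cases "nonconstant x")
    case False
    then have "\<And>i. x $ i = x $ undefined"
      by (auto simp: nonconstant_def)
    then have "N_fun \<mu> x = 0"
      using N_fun_const \<mu> by blast
    then show ?thesis
      using total_variation_nonneg[OF w] by simp
  next
    case True
    obtain y S d where x: "x = y + (\<chi> i. d * indicator S i)" and d: "d \<ge> 0" and S: "S \<notin> {{}, UNIV}"
      and card: "card (range (($) y)) < card (range (($) x))"
      and tv: "\<And>w. total_variation w x = total_variation w y + d * cut_weight w S"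
      using slice_top_level[OF True] by metis
    have "N_fun \<mu> x \<le> N_fun \<mu> y + N_fun \<mu> (\<chi> i. d * indicator S i)"
      unfolding x by (rule N_fun_subadditive) (rule \<mu>)
    also have "\<dots> \<le> N_fun \<mu> y + d * min (vol \<mu> S) (vol \<mu> (- S))"
      using N_fun_indicator_le[OF \<mu> d] by simp
    finally have "h * N_fun \<mu> x \<le> h * (N_fun \<mu> y + d * min (vol \<mu> S) (vol \<mu> (- S)))"
      using h by (rule mult_left_mono)
    also have "\<dots> = h * N_fun \<mu> y + d * (h * min (vol \<mu> S) (vol \<mu> (- S)))"
      by (simp add: algebra_simps)
    also have "\<dots> \<le> total_variation w y + d * cut_weight w S"
      using less[OF card] cut[OF S] d by (intro add_mono mult_left_mono)
    finally show ?thesis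
      by (simp add: tv)
  qed
qed

section \<open>Edge sums as sums over ordered pairs\<close>

context weighted_graph
begin

lemma weight_nonneg: "w i j \<ge> 0"
  using weight_pos[of i j] weight_zero[of i j] by (cases "{i, j} \<in> E") auto

lemma edge_if_weight: "w i j \<noteq> 0 \<Longrightarrow> {i, j} \<in> E"
  using weight_zero by blast

lemma edge_sum_weighted:
  "edge_sum E (\<lambda>i j. w i j * f i j) = (\<Sum>i\<in>UNIV. \<Sum>j\<in>UNIV. w i j * f i j) / 2"
proof -
  have "(\<Sum>(i, j) \<in> {(i, j). {i, j} \<in> E}. w i j * f i j) = (\<Sum>(i, j) \<in> UNIV \<times> UNIV. w i j * f i j)"
    by (intro sum.mono_neutral_left) (auto dest: edge_if_weight)
  then show ?thesis
    by (simp only: edge_sum_def sum.cartesian_product)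
qed

lemma edge_sum_edges_between: "edge_sum (edges_between E S (- S)) w = cut_weight w S"
proof -
  have "(\<Sum>(i, j) \<in> {(i, j). {i, j} \<in> edges_between E S (- S)}. w i j)
      = (\<Sum>(i, j) \<in> UNIV \<times> UNIV. if (i \<in> S) \<noteq> (j \<in> S) then w i j else 0)"
  proof (rule sum.mono_neutral_cong_left)
    have "{i, j} \<in> edges_between E S (- S) \<longleftrightarrow> {i, j} \<in> E \<and> (i \<in> S) \<noteq> (j \<in> S)" for i j
      by (auto simp: edges_between_def doubleton_eq_iff) (metis insert_commute)+
    then show "\<forall>p\<in>UNIV \<times> UNIV - {(i, j). {i, j} \<in> edges_between E S (- S)}.
        (case p of (i, j) \<Rightarrow> if (i \<in> S) \<noteq> (j \<in> S) then w i j else 0) = 0"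
      and "\<And>p. p \<in> {(i, j). {i, j} \<in> edges_between E S (- S)} \<Longrightarrow>
        (case p of (i, j) \<Rightarrow> w i j) = (case p of (i, j) \<Rightarrow> if (i \<in> S) \<noteq> (j \<in> S) then w i j else 0)"
      by (auto dest: edge_if_weight split: if_splits)
  qed auto
  then show ?thesis
    by (simp only: edge_sum_def cut_weight_def sum.cartesian_product)
qed

lemma total_degree_eq: "total_degree E w = (\<Sum>i\<in>UNIV. \<Sum>j\<in>UNIV. w i j)"
  unfolding total_degree_def vertex_degree_def
  by (intro sum.cong sum.mono_neutral_left) (auto dest: edge_if_weight)

lemma numerator_eq:
  "total_degree E w * infnorm x - I_plus E w x
    = (\<Sum>i\<in>UNIV. \<Sum>j\<in>UNIV. w i j * (2 * infnorm x - \<bar>x $ i + x $ j\<bar>)) / 2"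
  by (simp add: total_degree_eq I_plus_def edge_sum_weighted right_diff_distrib sum_subtractf
      diff_divide_distrib sum_distrib_right mult.assoc sum_divide_distrib)

lemma total_variation_le_numerator:
  "total_variation w x \<le> total_degree E w * infnorm x - I_plus E w x"
proof -
  have "\<bar>x $ i - x $ j\<bar> \<le> 2 * infnorm x - \<bar>x $ i + x $ j\<bar>" for i j
    using component_le_infnorm_cart[of x i] component_le_infnorm_cart[of x j] by linarith
  then show ?thesis
    unfolding numerator_eq total_variation_def
    by (intro divide_right_mono sum_mono mult_left_mono weight_nonneg) auto
qed

lemma numerator_sign_vector:
  fixes S :: "'n set"
  defines "x \<equiv> (\<chi> i. if i \<in> S then 1 else - 1) :: real ^ 'n"
  shows "total_degree E w * infnorm x - I_plus E w x = 2 * cut_weight w S"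
proof -
  have "{\<bar>x $ i\<bar> | i. i \<in> UNIV} = {1}"
    by (auto simp: x_def)
  then have "infnorm x = 1"
    by (simp add: infnorm_cart)
  then have "w i j * (2 * infnorm x - \<bar>x $ i + x $ j\<bar>)
      = 2 * (if (i \<in> S) \<noteq> (j \<in> S) then w i j else 0)" for i j
    by (simp add: x_def)
  then show ?thesis
    unfolding numerator_eq cut_weight_def by (simp flip: sum_distrib_left)
qed

section \<open>The balanced cut\<close>

lemma min_vol_pos:
  assumes "S \<notin> {{}, UNIV}"
  shows "min (vol \<mu> S) (vol \<mu> (- S)) > 0"
  using assms vertex_weight_pos by (auto simp: vol_def intro!: sum_pos)

lemma finite_cut_ratios:
  "finite {edge_sum (edges_between E S (- S)) w / min (vol \<mu> S) (vol \<mu> (- S)) | S. S \<notin> {{}, UNIV}}"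
  by (simp add: setcompr_eq_image)

lemma balanced_cut_attained:
  obtains S where "S \<notin> {{}, UNIV}"
    "balanced_cut E w \<mu> = cut_weight w S / min (vol \<mu> S) (vol \<mu> (- S))"
proof -
  fix a :: 'n
  have "{a} \<noteq> UNIV"
    using card_vertices by (metis card_1_singleton_iff One_nat_def not_less_eq_eq numeral_2_eq_2 le_refl)
  then have "{a} \<notin> {{}, UNIV}"
    by simp
  then have "balanced_cut E w \<mu> \<in> {edge_sum (edges_between E S (- S)) w
      / min (vol \<mu> S) (vol \<mu> (- S)) | S. S \<notin> {{}, UNIV}}"
    unfolding balanced_cut_def by (intro Min_in finite_cut_ratios) blast
  then show thesis
    using that by (auto simp: edge_sum_edges_between)
qed

lemma balanced_cut_times_vol_le:
  assumes "S \<notin> {{}, UNIV}"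
  shows "balanced_cut E w \<mu> * min (vol \<mu> S) (vol \<mu> (- S)) \<le> cut_weight w S"
proof -
  have "balanced_cut E w \<mu> \<le> edge_sum (edges_between E S (- S)) w / min (vol \<mu> S) (vol \<mu> (- S))"
    unfolding balanced_cut_def using assms by (intro Min_le finite_cut_ratios) blast
  then show ?thesis
    using min_vol_pos[OF assms] by (simp add: edge_sum_edges_between pos_le_divide_eq)
qed

lemma cut_weight_nonneg: "cut_weight w S \<ge> 0"
  unfolding cut_weight_def by (intro divide_nonneg_pos sum_nonneg) (auto simp: weight_nonneg)

lemma balanced_cut_nonneg: "balanced_cut E w \<mu> \<ge> 0"
proof -
  obtain S where "S \<notin> {{}, UNIV}"
    "balanced_cut E w \<mu> = cut_weight w S / min (vol \<mu> S) (vol \<mu> (- S))"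
    by (rule balanced_cut_attained)
  then show ?thesis
    using min_vol_pos[of S] cut_weight_nonneg[of S] by simp
qed

lemma balanced_cut_le:
  assumes "nonconstant x"
  shows "balanced_cut E w \<mu> \<le> (total_degree E w * infnorm x - I_plus E w x) / N_fun \<mu> x"
proof -
  have "balanced_cut E w \<mu> * N_fun \<mu> x \<le> total_variation w x"
    by (intro cut_bound_imp_variation_bound weight_nonneg less_imp_le vertex_weight_pos
        balanced_cut_nonneg balanced_cut_times_vol_le)
  then show ?thesis
    using total_variation_le_numerator[of x] N_fun_pos[OF vertex_weight_pos assms]
    by (simp add: pos_le_divide_eq)
qed

lemma sign_vector_optimal:
  assumes S: "S \<notin> {{}, UNIV}"
    and opt: "balanced_cut E w \<mu> = cut_weight w S / min (vol \<mu> S) (vol \<mu> (- S))"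
  defines "x \<equiv> (\<chi> i. if i \<in> S then 1 else - 1) :: real ^ 'n"
  shows "nonconstant x"
    and "balanced_cut E w \<mu> = (total_degree E w * infnorm x - I_plus E w x) / N_fun \<mu> x"
proof -
  obtain i j where "i \<in> S" "j \<notin> S"
    using S by blast
  then have "x $ i \<noteq> x $ j"
    by (simp add: x_def)
  then show nc: "nonconstant x"
    unfolding nonconstant_def by blast
  let ?m = "min (vol \<mu> S) (vol \<mu> (- S))"
  have N: "2 * ?m \<le> N_fun \<mu> x"
    unfolding x_def by (intro N_fun_sign_vector less_imp_le vertex_weight_pos)
  have "(total_degree E w * infnorm x - I_plus E w x) / N_fun \<mu> x = 2 * cut_weight w S / N_fun \<mu> x"
    by (simp only: x_def numerator_sign_vector)
  also have "\<dots> \<le> 2 * cut_weight w S / (2 * ?m)"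
    using N min_vol_pos[OF S] cut_weight_nonneg[of S] by (intro divide_left_mono) auto
  also have "\<dots> = balanced_cut E w \<mu>"
    by (simp add: opt)
  finally show "balanced_cut E w \<mu> = (total_degree E w * infnorm x - I_plus E w x) / N_fun \<mu> x"
    using balanced_cut_le[OF nc] by simp
qed

end

theorem mainTheorem2:
  fixes E :: "'n::finite set set"
    and w :: "'n \<Rightarrow> 'n \<Rightarrow> real"
    and \<mu> :: "'n \<Rightarrow> real"
  assumes "weighted_graph E w \<mu>"
  shows "(\<exists>x :: real ^ 'n. nonconstant x \<and>
            balanced_cut E w \<mu> = (total_degree E w * infnorm x - I_plus E w x) / N_fun \<mu> x)
       \<and> (\<forall>x :: real ^ 'n. nonconstant x \<longrightarrow>
            balanced_cut E w \<mu> \<le> (total_degree E w * infnorm x - I_plus E w x) / N_fun \<mu> x)"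
proof -
  interpret weighted_graph E w \<mu>
    by (rule assms)
  obtain S where "S \<notin> {{}, UNIV}"
    "balanced_cut E w \<mu> = cut_weight w S / min (vol \<mu> S) (vol \<mu> (- S))"
    by (rule balanced_cut_attained)
  then show ?thesis
    using sign_vector_optimal balanced_cut_le by blast
qed

end
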